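(* Let $L>0$, $\mu>0$, let $f:\mathbb{R}^d\to\mathbb{R}$ be differentiable with $L$-Lipschitz continuous gradient (not necessarily convex), let $h:\mathbb{R}^d\to\mathbb{R}\cup\{+\infty\}$ be closed, proper and convex, and let $F=f+h$ have a nonempty set of global minimizers, with minimum value $F_*$. Let $x_1\in\mathbb{R}^d$, and suppose that $d(0,\partial F(x))^2\ge 2\mu(F(x)-F_* )$ for all $x$ with $F(x)\le F(x_1)$. Define the worst-case rate bound $\tau:(0,\frac2L)\to\mathbb{R}$ by $$\tau(\gamma)=\begin{cases}\dfrac{(L\gamma+1)^2}{(L\gamma+1)^2+L\gamma^2\mu+2\gamma\mu}, & \gamma\in\left(0,\frac{\sqrt3}{L}\right],\\[2ex] \dfrac{(L\gamma-1)^2}{(L\gamma-1)^2-L\gamma^2\mu+2\gamma\mu}, & \gamma\in\left(\frac{\sqrt3}{L},\frac2L\right).\end{cases}$$ Then the optimal step size for this bound, i.e. the minimizer of $\tau$ over $(0,\frac2L)$, is $\gamma=\frac{\sqrt3}{L}$.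
   Context: $\partial F(x)$ is the Clarke subdifferential, which here equals $\nabla f(x)+\partial h(x)$ with $\partial h$ the convex subdifferential; $d(0,S)=\inf_{s\in S}\|s\|$ for nonempty $S$, with the convention $d(0,\emptyset)=+\infty$. The function $\tau(\gamma)$ is the contraction factor in the bound $F(x_2)-F_*\le\tau(\gamma)(F(x_1)-F_* )$ for one proximal gradient step $x_2=\mathrm{prox}_{\gamma h}(x_1-\gamma\nabla f(x_1))$, where $\mathrm{prox}_g(x)=\operatorname{argmin}_y\{g(y)+\frac12\|y-x\|^2\}$. "Optimal" step size means the one minimizing this bound. *)

theory Defs
  imports "HOL-Analysis.Analysis"
begin

section \<open>Extended-real-valued functions\<close>

definition epi :: "('a \<Rightarrow> ereal) \<Rightarrow> ('a \<times> real) set" where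
  "epi g = {(x, r). g x \<le> ereal r}"

definition proper_fun :: "('a \<Rightarrow> ereal) \<Rightarrow> bool" where
  "proper_fun g \<longleftrightarrow> (\<forall>x. g x \<noteq> -\<infinity>) \<and> (\<exists>x. g x \<noteq> \<infinity>)"

definition closed_fun :: "('a::topological_space \<Rightarrow> ereal) \<Rightarrow> bool" where
  "closed_fun g \<longleftrightarrow> closed (epi g)"

definition convex_fun :: "('a::real_vector \<Rightarrow> ereal) \<Rightarrow> bool" where
  "convex_fun g \<longleftrightarrow> convex (epi g)"


section \<open>Subdifferentials\<close>

text \<open>
  The Clarke subdifferential of an extended-real-valued function is defined, as usual, from
  the Clarke normal cone to its epigraph. It is empty at points where the function is not finite.
\<close>

definition clarke_tangent_cone :: "'a::real_normed_vector set \<Rightarrow> 'a \<Rightarrow> 'a set" where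
  "clarke_tangent_cone C z =
     {v. \<forall>zs ts. (\<forall>n. zs n \<in> C) \<and> zs \<longlonglongrightarrow> z \<and> (\<forall>n. 0 < ts n) \<and> ts \<longlonglongrightarrow> (0::real) \<longrightarrow>
           (\<exists>vs. vs \<longlonglongrightarrow> v \<and> (\<forall>n. zs n + ts n *\<^sub>R vs n \<in> C))}"

definition clarke_normal_cone :: "'a::real_inner set \<Rightarrow> 'a \<Rightarrow> 'a set" where
  "clarke_normal_cone C z = {w. \<forall>v\<in>clarke_tangent_cone C z. w \<bullet> v \<le> 0}"

definition clarke_subdifferential :: "('a::real_inner \<Rightarrow> ereal) \<Rightarrow> 'a \<Rightarrow> 'a set" where
  "clarke_subdifferential g x =
     {v. \<exists>r. g x = ereal r \<and> (v, -1) \<in> clarke_normal_cone (epi g) (x, r)}"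

definition convex_subdifferential :: "('a::real_inner \<Rightarrow> ereal) \<Rightarrow> 'a \<Rightarrow> 'a set" where
  "convex_subdifferential g x =
     {v. \<bar>g x\<bar> \<noteq> \<infinity> \<and> (\<forall>y. g x + ereal (v \<bullet> (y - x)) \<le> g y)}"

text \<open>
  In the complete lattice of extended reals, the infimum over the empty set is \<open>\<infinity>\<close>.
\<close>

definition dist_zero :: "'a::real_normed_vector set \<Rightarrow> ereal" where
  "dist_zero S = (INF s\<in>S. ereal (norm s))"


section \<open>The rate bound\<close>

definition rate_bound :: "real \<Rightarrow> real \<Rightarrow> real \<Rightarrow> real" where
  "rate_bound L \<mu> \<gamma> =
     (if \<gamma> \<le> sqrt 3 / L
      then (L * \<gamma> + 1)\<^sup>2 / ((L * \<gamma> + 1)\<^sup>2 + L * \<gamma>\<^sup>2 * \<mu> + 2 * \<gamma> * \<mu>)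
      else (L * \<gamma> - 1)\<^sup>2 / ((L * \<gamma> - 1)\<^sup>2 - L * \<gamma>\<^sup>2 * \<mu> + 2 * \<gamma> * \<mu>))"


section \<open>The Clarke subdifferential of a smooth plus a convex function\<close>

lemma difference_quotient_tendsto:
  fixes f :: "'a::real_inner \<Rightarrow> real"
  assumes der: "\<And>x. GDERIV f x :> g x" and cont: "isCont g x"
    and xs: "xs \<longlonglongrightarrow> x" and ts: "ts \<longlonglongrightarrow> 0" "\<And>n. 0 < ts n" and us: "us \<longlonglongrightarrow> u"
  shows "(\<lambda>n. (f (xs n + ts n *\<^sub>R us n) - f (xs n)) / ts n) \<longlonglongrightarrow> u \<bullet> g x"
proof -
  have "\<exists>\<xi>>0. \<xi> < ts n \<and> f (xs n + ts n *\<^sub>R us n) - f (xs n)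
          = ts n * (us n \<bullet> g (xs n + \<xi> *\<^sub>R us n))" for n
  proof -
    have D: "((\<lambda>s. f (xs n + s *\<^sub>R us n)) has_real_derivative (us n \<bullet> g (xs n + s *\<^sub>R us n))) (at s)"
      for s
    proof -
      have "(f has_derivative (\<lambda>h. h \<bullet> g (xs n + s *\<^sub>R us n))) (at (xs n + s *\<^sub>R us n))"
        using der[of "xs n + s *\<^sub>R us n"] by (simp add: gderiv_def)
      moreover have "((\<lambda>s. xs n + s *\<^sub>R us n) has_derivative (\<lambda>h. h *\<^sub>R us n)) (at s)"
        by (auto intro!: derivative_eq_intros)
      ultimately have "((\<lambda>s. f (xs n + s *\<^sub>R us n)) has_derivative
          (\<lambda>h. (h *\<^sub>R us n) \<bullet> g (xs n + s *\<^sub>R us n))) (at s)"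
        by (rule has_derivative_compose[rotated])
      then show ?thesis
        by (simp add: has_field_derivative_def mult_commute_abs)
    qed
    show ?thesis
      using MVT2[OF ts(2)[of n], of "\<lambda>s. f (xs n + s *\<^sub>R us n)"
          "\<lambda>s. us n \<bullet> g (xs n + s *\<^sub>R us n)"] D by auto
  qed
  then obtain \<xi> where \<xi>: "\<And>n. 0 < \<xi> n" "\<And>n. \<xi> n < ts n"
    "\<And>n. f (xs n + ts n *\<^sub>R us n) - f (xs n) = ts n * (us n \<bullet> g (xs n + \<xi> n *\<^sub>R us n))"
    by metis
  have "\<xi> \<longlonglongrightarrow> 0"
    by (rule tendsto_sandwich[OF _ _ tendsto_const ts(1)])
      (use \<xi> in \<open>auto intro!: always_eventually less_imp_le\<close>)
  then have "(\<lambda>n. xs n + \<xi> n *\<^sub>R us n) \<longlonglongrightarrow> x + 0 *\<^sub>R u"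
    by (intro tendsto_intros xs us)
  then have "(\<lambda>n. g (xs n + \<xi> n *\<^sub>R us n)) \<longlonglongrightarrow> g x"
    by (intro isCont_tendsto_compose[OF cont]) simp
  then have "(\<lambda>n. us n \<bullet> g (xs n + \<xi> n *\<^sub>R us n)) \<longlonglongrightarrow> u \<bullet> g x"
    by (intro tendsto_intros us)
  moreover have "(f (xs n + ts n *\<^sub>R us n) - f (xs n)) / ts n = us n \<bullet> g (xs n + \<xi> n *\<^sub>R us n)" for n
    using \<xi>(3)[of n] ts(2)[of n] by simp
  ultimately show ?thesis by simp
qed

lemma epi_add_smooth:
  "(x, r) \<in> epi (\<lambda>x. ereal (f x) + h x) \<longleftrightarrow> (x, r - f x) \<in> epi h"
  unfolding epi_def by (cases "h x") (auto simp: algebra_simps)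

lemma clarke_tangent_add_smooth1:
  fixes f :: "'a::real_inner \<Rightarrow> real"
  assumes der: "\<And>x. GDERIV f x :> g x" and cont: "isCont g x"
    and T: "(u, s) \<in> clarke_tangent_cone (epi h) (x, r)"
  shows "(u, s + u \<bullet> g x) \<in> clarke_tangent_cone (epi (\<lambda>x. ereal (f x) + h x)) (x, f x + r)"
  unfolding clarke_tangent_cone_def
proof (safe)
  fix zs :: "nat \<Rightarrow> 'a \<times> real" and ts :: "nat \<Rightarrow> real"
  assume zs: "\<forall>n. zs n \<in> epi (\<lambda>x. ereal (f x) + h x)" "zs \<longlonglongrightarrow> (x, f x + r)"
    and ts: "\<forall>n. 0 < ts n" "ts \<longlonglongrightarrow> 0"
  define xs where "xs n = fst (zs n)" for n
  have xs: "xs \<longlonglongrightarrow> x" using tendsto_fst[OF zs(2)] by (simp add: xs_def[abs_def])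
  have rs: "(\<lambda>n. snd (zs n)) \<longlonglongrightarrow> f x + r" using tendsto_snd[OF zs(2)] by simp
  have "isCont f x"
    using der[of x] by (auto simp: gderiv_def intro: has_derivative_continuous)
  then have fxs: "(\<lambda>n. f (xs n)) \<longlonglongrightarrow> f x" using xs by (rule isCont_tendsto_compose)
  define ys where "ys n = (xs n, snd (zs n) - f (xs n))" for n
  have ys1: "\<forall>n. ys n \<in> epi h"
    using zs(1) by (metis epi_add_smooth prod.collapse xs_def ys_def)
  have "ys \<longlonglongrightarrow> (x, (f x + r) - f x)"
    unfolding ys_def[abs_def] by (intro tendsto_intros xs rs fxs)
  then have ys2: "ys \<longlonglongrightarrow> (x, r)" by simp
  obtain vs where vs: "vs \<longlonglongrightarrow> (u, s)" "\<And>n. ys n + ts n *\<^sub>R vs n \<in> epi h"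
    using T ys1 ys2 ts unfolding clarke_tangent_cone_def by blast
  define us where "us n = fst (vs n)" for n
  define q where "q n = (f (xs n + ts n *\<^sub>R us n) - f (xs n)) / ts n" for n
  have us: "us \<longlonglongrightarrow> u" using tendsto_fst[OF vs(1)] by (simp add: us_def[abs_def])
  have ss: "(\<lambda>n. snd (vs n)) \<longlonglongrightarrow> s" using tendsto_snd[OF vs(1)] by simp
  have q: "q \<longlonglongrightarrow> u \<bullet> g x"
    unfolding q_def[abs_def]
    by (rule difference_quotient_tendsto[of f g x, OF der cont xs ts(2) _ us]) (use ts in auto)
  show "\<exists>ws. ws \<longlonglongrightarrow> (u, s + u \<bullet> g x) \<and>
          (\<forall>n. zs n + ts n *\<^sub>R ws n \<in> epi (\<lambda>x. ereal (f x) + h x))"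
  proof (intro exI conjI allI)
    show "(\<lambda>n. (us n, snd (vs n) + q n)) \<longlonglongrightarrow> (u, s + u \<bullet> g x)"
      by (intro tendsto_intros us ss q)
    fix n
    have "ts n * q n = f (xs n + ts n *\<^sub>R us n) - f (xs n)"
      using ts(1) by (simp add: q_def less_imp_neq[symmetric])
    then have *: "zs n + ts n *\<^sub>R (us n, snd (vs n) + q n) =
        (xs n + ts n *\<^sub>R us n,
         snd (zs n) + ts n * snd (vs n) + f (xs n + ts n *\<^sub>R us n) - f (xs n))"
      by (simp add: prod_eq_iff xs_def algebra_simps)
    have "ys n + ts n *\<^sub>R vs n =
        (xs n + ts n *\<^sub>R us n,
         snd (zs n) + ts n * snd (vs n) + f (xs n + ts n *\<^sub>R us n) - f (xs n)
           - f (xs n + ts n *\<^sub>R us n))"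
      by (simp add: prod_eq_iff ys_def us_def)
    then show "zs n + ts n *\<^sub>R (us n, snd (vs n) + q n) \<in> epi (\<lambda>x. ereal (f x) + h x)"
      unfolding * epi_add_smooth using vs(2)[of n] by (simp only:)
  qed
qed

lemma clarke_tangent_add_smooth:
  fixes f :: "'a::real_inner \<Rightarrow> real"
  assumes der: "\<And>x. GDERIV f x :> g x" and cont: "isCont g x"
  shows "(u, s + u \<bullet> g x) \<in> clarke_tangent_cone (epi (\<lambda>x. ereal (f x) + h x)) (x, f x + r)
     \<longleftrightarrow> (u, s) \<in> clarke_tangent_cone (epi h) (x, r)"
proof
  assume "(u, s + u \<bullet> g x) \<in> clarke_tangent_cone (epi (\<lambda>x. ereal (f x) + h x)) (x, f x + r)"
  from clarke_tangent_add_smooth1[where f = "\<lambda>x. - f x" and g = "\<lambda>x. - g x", OF _ _ this]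
  have "(u, s) \<in> clarke_tangent_cone (epi (\<lambda>x. ereal (- f x) + (ereal (f x) + h x))) (x, r)"
    using GDERIV_minus[OF der] cont by simp
  moreover have "ereal (- f x) + (ereal (f x) + h x) = h x" for x
    by (cases "h x") auto
  ultimately show "(u, s) \<in> clarke_tangent_cone (epi h) (x, r)" by simp
next
  assume "(u, s) \<in> clarke_tangent_cone (epi h) (x, r)"
  then show "(u, s + u \<bullet> g x) \<in> clarke_tangent_cone (epi (\<lambda>x. ereal (f x) + h x)) (x, f x + r)"
    by (rule clarke_tangent_add_smooth1[where f = f and g = g, OF der cont])
qed

lemma clarke_normal_cone_convex:
  fixes C :: "'a::real_inner set"
  assumes C: "convex C" and z: "z \<in> C"
  shows "clarke_normal_cone C z = {w. \<forall>c\<in>C. w \<bullet> (c - z) \<le> 0}"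
proof (intro equalityI subsetI CollectI ballI)
  fix w c assume w: "w \<in> clarke_normal_cone C z" and c: "c \<in> C"
  have "c - z \<in> clarke_tangent_cone C z"
    unfolding clarke_tangent_cone_def
  proof (safe)
    fix zs :: "nat \<Rightarrow> 'a" and ts :: "nat \<Rightarrow> real"
    assume zs: "\<forall>n. zs n \<in> C" "zs \<longlonglongrightarrow> z" and ts: "\<forall>n. 0 < ts n" "ts \<longlonglongrightarrow> 0"
    define vs where "vs n = (if ts n \<le> 1 then c - zs n else 0)" for n
    have "\<forall>\<^sub>F n in sequentially. ts n < 1" using ts(2) by (rule order_tendstoD) simp
    then have "\<forall>\<^sub>F n in sequentially. c - zs n = vs n"
      by eventually_elim (simp add: vs_def)
    moreover have "(\<lambda>n. c - zs n) \<longlonglongrightarrow> c - z" by (intro tendsto_intros zs)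
    ultimately have "vs \<longlonglongrightarrow> c - z" by (rule Lim_transform_eventually[rotated])
    moreover have "zs n + ts n *\<^sub>R vs n \<in> C" for n
    proof (cases "ts n \<le> 1")
      case True
      then have "(1 - ts n) *\<^sub>R zs n + ts n *\<^sub>R c \<in> C"
        using C zs(1) c ts(1) by (intro convexD) (auto intro: less_imp_le)
      then show ?thesis using True by (simp add: vs_def algebra_simps)
    qed (use zs in \<open>simp add: vs_def\<close>)
    ultimately show "\<exists>vs. vs \<longlonglongrightarrow> c - z \<and> (\<forall>n. zs n + ts n *\<^sub>R vs n \<in> C)" by blast
  qed
  then show "w \<bullet> (c - z) \<le> 0" using w by (auto simp: clarke_normal_cone_def)
next
  fix w assume "w \<in> {w. \<forall>c\<in>C. w \<bullet> (c - z) \<le> 0}"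
  then have w: "w \<bullet> (c - z) \<le> 0" if "c \<in> C" for c using that by blast
  show "w \<in> clarke_normal_cone C z"
    unfolding clarke_normal_cone_def
  proof (intro CollectI ballI)
    fix v assume v: "v \<in> clarke_tangent_cone C z"
    have "(\<lambda>n. 1 / real (Suc n)) \<longlonglongrightarrow> 0"
      using LIMSEQ_inverse_real_of_nat by (simp add: inverse_eq_divide)
    with v z obtain vs where vs: "vs \<longlonglongrightarrow> v" "\<And>n. z + (1 / real (Suc n)) *\<^sub>R vs n \<in> C"
      unfolding clarke_tangent_cone_def mem_Collect_eq
      by (elim allE[of _ "\<lambda>_. z"] allE[of _ "\<lambda>n. 1 / real (Suc n)"]) auto
    have "w \<bullet> vs n \<le> 0" for n
      using w[OF vs(2)[of n]] by (simp add: divide_le_0_iff)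
    moreover have "(\<lambda>n. w \<bullet> vs n) \<longlonglongrightarrow> w \<bullet> v" by (intro tendsto_intros vs)
    ultimately show "w \<bullet> v \<le> 0" by (intro LIMSEQ_le_const2) auto
  qed
qed

lemma clarke_subdifferential_convex:
  fixes h :: "'a::real_inner \<Rightarrow> ereal"
  assumes "convex_fun h"
  shows "clarke_subdifferential h x = convex_subdifferential h x"
proof (cases "h x")
  case (real r)
  have C: "convex (epi h)" "(x, r) \<in> epi h"
    using assms real by (auto simp: convex_fun_def epi_def)
  have "(\<forall>c\<in>epi h. (v, -1) \<bullet> (c - (x, r)) \<le> 0) \<longleftrightarrow> (\<forall>y. h x + ereal (v \<bullet> (y - x)) \<le> h y)" for v
  proof -
    have "(\<forall>c\<in>epi h. (v, -1) \<bullet> (c - (x, r)) \<le> 0)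
        \<longleftrightarrow> (\<forall>y s. h y \<le> ereal s \<longrightarrow> r + v \<bullet> (y - x) \<le> s)"
      by (auto simp: epi_def algebra_simps)
    also have "\<dots> \<longleftrightarrow> (\<forall>y. ereal (r + v \<bullet> (y - x)) \<le> h y)"
    proof (intro iffI allI impI)
      fix y assume *: "\<forall>y s. h y \<le> ereal s \<longrightarrow> r + v \<bullet> (y - x) \<le> s"
      show "ereal (r + v \<bullet> (y - x)) \<le> h y"
        by (rule ereal_le_real) (use * in simp)
    next
      fix y s assume "\<forall>y. ereal (r + v \<bullet> (y - x)) \<le> h y" "h y \<le> ereal s"
      then have "ereal (r + v \<bullet> (y - x)) \<le> ereal s" by (metis order_trans)
      then show "r + v \<bullet> (y - x) \<le> s" by simp
    qed
    finally show ?thesis using real by simp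
  qed
  then show ?thesis
    unfolding clarke_subdifferential_def convex_subdifferential_def
    using real by (simp add: clarke_normal_cone_convex[OF C])
qed (auto simp: clarke_subdifferential_def convex_subdifferential_def)

theorem clarke_subdifferential_add_smooth:
  fixes f :: "'a::real_inner \<Rightarrow> real" and h :: "'a \<Rightarrow> ereal"
  assumes der: "\<And>x. GDERIV f x :> g x" and cont: "isCont g x" and h: "convex_fun h"
  shows "clarke_subdifferential (\<lambda>x. ereal (f x) + h x) x =
         (+) (g x) ` convex_subdifferential h x"
proof (cases "h x")
  case (real r)
  let ?F = "\<lambda>x. ereal (f x) + h x"
  have "(v, -1) \<in> clarke_normal_cone (epi ?F) (x, f x + r) \<longleftrightarrow>
        (v - g x, -1) \<in> clarke_normal_cone (epi h) (x, r)" for v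
  proof -
    let ?T = "clarke_tangent_cone (epi ?F) (x, f x + r)"
    have shift: "(\<forall>u s. P u s) \<longleftrightarrow> (\<forall>u s. P u (s + u \<bullet> g x))" for P :: "'a \<Rightarrow> real \<Rightarrow> bool"
      by (metis diff_add_cancel)
    have "(v, -1) \<in> clarke_normal_cone (epi ?F) (x, f x + r) \<longleftrightarrow>
          (\<forall>u s. (u, s) \<in> ?T \<longrightarrow> v \<bullet> u - s \<le> 0)"
      unfolding clarke_normal_cone_def by force
    also have "\<dots> \<longleftrightarrow> (\<forall>u s. (u, s + u \<bullet> g x) \<in> ?T \<longrightarrow> v \<bullet> u - (s + u \<bullet> g x) \<le> 0)"
      by (rule shift)
    also have "\<dots> \<longleftrightarrow> (\<forall>u s. (u, s) \<in> clarke_tangent_cone (epi h) (x, r) \<longrightarrow>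
                              v \<bullet> u - (s + u \<bullet> g x) \<le> 0)"
      unfolding clarke_tangent_add_smooth[OF der cont] ..
    also have "\<dots> \<longleftrightarrow> (\<forall>u s. (u, s) \<in> clarke_tangent_cone (epi h) (x, r) \<longrightarrow>
                              (v - g x) \<bullet> u - s \<le> 0)"
      by (simp add: inner_diff_left inner_commute[of "g x"] diff_diff_eq2 diff_diff_add add.commute)
    also have "\<dots> \<longleftrightarrow> (v - g x, -1) \<in> clarke_normal_cone (epi h) (x, r)"
      unfolding clarke_normal_cone_def by force
    finally show ?thesis .
  qed
  then have "v \<in> clarke_subdifferential ?F x \<longleftrightarrow> v - g x \<in> clarke_subdifferential h x" for v
    using real by (simp add: clarke_subdifferential_def)
  then show ?thesis
    unfolding clarke_subdifferential_convex[OF h, symmetric]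
    by (force simp: image_iff)
qed (auto simp: clarke_subdifferential_def convex_subdifferential_def)

end

theory Submission
  imports Defs
begin

text \<open>
  With \<open>t = L * \<gamma>\<close> the numerators of the two branches are \<open>(t + 1)\<^sup>2\<close> and \<open>(t - 1)\<^sup>2\<close>, and
  \<open>L * \<gamma>\<^sup>2 * \<mu> + 2 * \<gamma> * \<mu> = (\<mu> / L) * ((t + 1)\<^sup>2 - 1)\<close>, whereas
  \<open>2 * \<gamma> * \<mu> - L * \<gamma>\<^sup>2 * \<mu> = (\<mu> / L) * (1 - (t - 1)\<^sup>2)\<close>. Dividing by the numerator puts both
  branches into the form \<open>1 / (1 + (\<mu> / L) * step_gain t)\<close>
  (\<open>rate_bound_eq_step_gain\<close>), where \<open>step_gain t\<close> is \<open>1 - 1 / (t + 1)\<^sup>2\<close> or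
  \<open>1 / (t - 1)\<^sup>2 - 1\<close>. Since the gain is nonnegative on \<open>(0, 2)\<close>, minimizing the bound means
  maximizing the gain, a question about \<open>t\<close> alone, in which \<open>L\<close> and \<open>\<mu>\<close> no longer occur.
  The first expression strictly increases on \<open>t > 0\<close>, the second strictly decreases on
  \<open>t > 1\<close>, and they meet at \<open>t = sqrt 3\<close> with the common value \<open>sqrt 3 / 2\<close>; hence \<open>sqrt 3\<close>
  is the unique maximizer on \<open>(0, 2)\<close>
  (\<open>step_gain_less_sqrt3\<close>).
\<close>

definition step_gain :: "real \<Rightarrow> real" where
  "step_gain t = (if t \<le> sqrt 3 then 1 - 1 / (t + 1)\<^sup>2 else 1 / (t - 1)\<^sup>2 - 1)"

lemma sqrt3_bounds: "1 < sqrt 3" "sqrt 3 < 2"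
  by (auto intro: real_less_rsqrt real_less_lsqrt)

lemma divide_add_scaled_eq:
  fixes u v c :: real
  assumes "u > 0"
  shows "u / (u + c * v) = 1 / (1 + c * (v / u))"
proof -
  have "u + c * v = u * (1 + c * (v / u))"
    using assms by (simp add: distrib_left)
  then show ?thesis
    using assms by (simp only: divide_divide_eq_left[symmetric]) simp
qed

lemma rate_bound_eq_step_gain:
  assumes "L > 0" and "\<gamma> > 0"
  shows "rate_bound L \<mu> \<gamma> = 1 / (1 + \<mu> / L * step_gain (L * \<gamma>))"
proof (cases "\<gamma> \<le> sqrt 3 / L")
  case True
  then have t: "L * \<gamma> \<le> sqrt 3"
    using assms by (simp add: pos_le_divide_eq mult.commute)
  define u where "u = (L * \<gamma> + 1)\<^sup>2"
  have "0 < L * \<gamma> + 1"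
    using assms by (intro add_pos_pos mult_pos_pos) auto
  then have u: "u > 0"
    by (simp add: u_def)
  have "L * \<gamma>\<^sup>2 * \<mu> + 2 * \<gamma> * \<mu> = \<mu> / L * (u - 1)"
    using assms by (simp add: u_def field_simps power2_eq_square)
  then have "rate_bound L \<mu> \<gamma> = u / (u + \<mu> / L * (u - 1))"
    using True unfolding rate_bound_def u_def[symmetric] by (simp only: if_True add.assoc)
  also have "\<dots> = 1 / (1 + \<mu> / L * ((u - 1) / u))"
    using u by (rule divide_add_scaled_eq)
  also have "(u - 1) / u = step_gain (L * \<gamma>)"
    using t u unfolding step_gain_def u_def[symmetric] by (simp add: diff_divide_distrib)
  finally show ?thesis .
next
  case False
  then have t: "L * \<gamma> > sqrt 3"
    using assms by (simp add: pos_divide_less_eq mult.commute not_le)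
  define u where "u = (L * \<gamma> - 1)\<^sup>2"
  have "0 < L * \<gamma> - 1"
    using t sqrt3_bounds by linarith
  then have u: "u > 0"
    by (simp add: u_def)
  have "u - L * \<gamma>\<^sup>2 * \<mu> + 2 * \<gamma> * \<mu> = u + \<mu> / L * (1 - u)"
    using assms by (simp add: u_def field_simps power2_eq_square)
  then have "rate_bound L \<mu> \<gamma> = u / (u + \<mu> / L * (1 - u))"
    using False unfolding rate_bound_def u_def[symmetric] by (simp only: if_False)
  also have "\<dots> = 1 / (1 + \<mu> / L * ((1 - u) / u))"
    using u by (rule divide_add_scaled_eq)
  also have "(1 - u) / u = step_gain (L * \<gamma>)"
    using t u unfolding step_gain_def u_def[symmetric] by (simp add: diff_divide_distrib)
  finally show ?thesis .
qed

text \<open>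
  This is where the step size restriction \<open>t = L * \<gamma> < 2\<close> enters: it makes \<open>(t - 1)\<^sup>2 \<le> 1\<close> on the
  second branch. Nonnegativity keeps every denominator \<open>1 + (\<mu> / L) * step_gain t\<close> positive,
  whatever the size of \<open>\<mu> / L\<close>, so that a larger gain does give a smaller bound.
\<close>

lemma step_gain_nonneg:
  assumes "0 < t" and "t < 2"
  shows "0 \<le> step_gain t"
proof (cases "t \<le> sqrt 3")
  case True
  have "1 \<le> (t + 1)\<^sup>2"
    using assms by (simp add: one_le_power)
  with True show ?thesis
    by (simp add: step_gain_def divide_le_eq)
next
  case False
  then have "0 < t - 1" using sqrt3_bounds by linarith
  moreover from this have "(t - 1)\<^sup>2 \<le> 1"
    using assms by (simp add: power_le_one)
  ultimately show ?thesis
    using False by (simp add: step_gain_def)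
qed

text \<open>
  The switch at \<open>sqrt 3\<close> is where both branches take the same value, since
  \<open>1 / (sqrt 3 + 1)\<^sup>2 + 1 / (sqrt 3 - 1)\<^sup>2 = 2\<close>. The second form of the value is what the
  comparison with points to the right of \<open>sqrt 3\<close> needs.
\<close>

lemma step_gain_sqrt3:
  "step_gain (sqrt 3) = 1 - 1 / (sqrt 3 + 1)\<^sup>2"
  "step_gain (sqrt 3) = 1 / (sqrt 3 - 1)\<^sup>2 - 1"
proof -
  show *: "step_gain (sqrt 3) = 1 - 1 / (sqrt 3 + 1)\<^sup>2"
    by (simp add: step_gain_def)
  have "1 / (sqrt 3 + 1)\<^sup>2 = (sqrt 3 - 1)\<^sup>2 / 4" "1 / (sqrt 3 - 1)\<^sup>2 = (sqrt 3 + 1)\<^sup>2 / 4"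
  proof -
    have "(sqrt 3 + 1)\<^sup>2 * (sqrt 3 - 1)\<^sup>2 = ((sqrt 3 + 1) * (sqrt 3 - 1))\<^sup>2"
      by (simp only: power_mult_distrib)
    also have "(sqrt 3 + 1) * (sqrt 3 - 1) = 2"
      by (simp add: algebra_simps)
    finally have "(sqrt 3 + 1)\<^sup>2 * (sqrt 3 - 1)\<^sup>2 = 4" by simp
    moreover have "sqrt 3 + 1 > 0" "sqrt 3 - 1 > 0"
      using sqrt3_bounds by linarith+
    then have "(sqrt 3 + 1)\<^sup>2 > 0" "(sqrt 3 - 1)\<^sup>2 > 0"
      by (simp_all only: zero_less_power)
    ultimately show "1 / (sqrt 3 + 1)\<^sup>2 = (sqrt 3 - 1)\<^sup>2 / 4"
      "1 / (sqrt 3 - 1)\<^sup>2 = (sqrt 3 + 1)\<^sup>2 / 4"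
      by (simp_all add: divide_simps mult.commute)
  qed
  then show "step_gain (sqrt 3) = 1 / (sqrt 3 - 1)\<^sup>2 - 1"
    unfolding * by (simp add: power2_eq_square algebra_simps)
qed

lemma step_gain_less_sqrt3:
  assumes "0 < t" and "t \<noteq> sqrt 3"
  shows "step_gain t < step_gain (sqrt 3)"
proof (cases "t \<le> sqrt 3")
  case True
  then have "(t + 1)\<^sup>2 < (sqrt 3 + 1)\<^sup>2"
    using assms by (intro power_strict_mono) auto
  then have "1 / (sqrt 3 + 1)\<^sup>2 < 1 / (t + 1)\<^sup>2"
    using assms sqrt3_bounds by (intro divide_strict_left_mono mult_pos_pos zero_less_power) linarith+
  with True show ?thesis
    by (simp add: step_gain_sqrt3(1)) (simp add: step_gain_def)
next
  case False
  then have "(sqrt 3 - 1)\<^sup>2 < (t - 1)\<^sup>2"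
    using sqrt3_bounds by (intro power_strict_mono) auto
  then have "1 / (t - 1)\<^sup>2 < 1 / (sqrt 3 - 1)\<^sup>2"
    using False sqrt3_bounds
    by (intro divide_strict_left_mono mult_pos_pos zero_less_power) linarith+
  with False show ?thesis
    by (simp add: step_gain_sqrt3(2)) (simp add: step_gain_def)
qed

lemma rate_bound_sqrt3_less:
  assumes "L > 0" and "\<mu> > 0" and "0 < \<gamma>" "\<gamma> < 2 / L" and "\<gamma> \<noteq> sqrt 3 / L"
  shows "rate_bound L \<mu> (sqrt 3 / L) < rate_bound L \<mu> \<gamma>"
proof -
  have t: "0 < L * \<gamma>" "L * \<gamma> < 2" "L * \<gamma> \<noteq> sqrt 3"
    using assms by (auto simp: field_simps)
  have "0 \<le> \<mu> / L * step_gain (L * \<gamma>)"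
    using assms step_gain_nonneg[OF t(1,2)] by simp
  moreover have "\<mu> / L * step_gain (L * \<gamma>) < \<mu> / L * step_gain (sqrt 3)"
    using assms step_gain_less_sqrt3[OF t(1,3)] by (intro mult_strict_left_mono) auto
  ultimately have "1 / (1 + \<mu> / L * step_gain (sqrt 3)) < 1 / (1 + \<mu> / L * step_gain (L * \<gamma>))"
    by (intro divide_strict_left_mono mult_pos_pos) linarith+
  moreover have "L * (sqrt 3 / L) = sqrt 3" "0 < sqrt 3 / L"
    using assms by auto
  ultimately show ?thesis
    using assms(1,3) by (simp only: rate_bound_eq_step_gain)
qed

theorem proposition2:
  fixes L \<mu> :: real
    and f :: "real ^ 'n \<Rightarrow> real" and gradf :: "real ^ 'n \<Rightarrow> real ^ 'n"
    and h F :: "real ^ 'n \<Rightarrow> ereal" and Fstar :: ereal and x1 :: "real ^ 'n"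
  assumes "L > 0" and "\<mu> > 0"
    and "\<And>x. GDERIV f x :> gradf x" and "L-lipschitz_on UNIV gradf"
    and "closed_fun h" and "proper_fun h" and "convex_fun h"
    and "F = (\<lambda>x. ereal (f x) + h x)"
    and "\<exists>x. is_arg_min F (\<lambda>_. True) x \<and> F x = Fstar"
    and "\<And>x. F x \<le> F x1 \<Longrightarrow>
           (dist_zero (clarke_subdifferential F x))\<^sup>2 \<ge> ereal (2 * \<mu>) * (F x - Fstar)"
  shows "{\<gamma>. is_arg_min (rate_bound L \<mu>) (\<lambda>\<gamma>. \<gamma> \<in> {0<..<2 / L}) \<gamma>} = {sqrt 3 / L}"
proof -
  have mem: "sqrt 3 / L \<in> {0<..<2 / L}"
    using \<open>L > 0\<close> sqrt3_bounds by (simp add: divide_strict_right_mono)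
  have less: "rate_bound L \<mu> (sqrt 3 / L) < rate_bound L \<mu> \<gamma>"
    if "\<gamma> \<in> {0<..<2 / L}" "\<gamma> \<noteq> sqrt 3 / L" for \<gamma>
    using rate_bound_sqrt3_less[OF \<open>L > 0\<close> \<open>\<mu> > 0\<close>] that by simp
  have "is_arg_min (rate_bound L \<mu>) (\<lambda>\<gamma>. \<gamma> \<in> {0<..<2 / L}) \<gamma> \<longleftrightarrow> \<gamma> = sqrt 3 / L" for \<gamma>
    unfolding is_arg_min_def by (metis mem less less_asym)
  then show ?thesis by simp
qed

end
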